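(* Let $(X_\alpha,T_\alpha)$ be an odometer system with $\alpha=\langle\alpha_1,\alpha_2,\ldots\rangle$ and let $c\ge1$ be an integer such that for some $N\in\mathbb{Z}^+$, $\gcd(c,\alpha_i)=1$ for all $i\ge N$. Then $(X_\alpha,T_\alpha)$ has a bounded speedup $S$ with orbit number $c$ and with $S:X_\alpha\to X_\alpha$ minimal; that is, there is a bounded function $p:X_\alpha\to\mathbb{Z}^+$ such that $S(x)=T_\alpha^{p(x)}(x)$ is a minimal homeomorphism of $X_\alpha$ and every $T_\alpha$-orbit is the union of exactly $c$ different $S$-orbits.
   Context: Odometers: let $\alpha=\langle\alpha_1,\alpha_2,\ldots\rangle$ be a sequence of integers with every $\alpha_i\ge 2$. $X_\alpha$ is the set of sequences $(x_1,x_2,\ldots)$ with $0\le x_i\le\alpha_i-1$, with the product topology. Addition on $X_\alpha$ is coordinatewise with carrying to the right: $(x_i)+(y_i)=(z_i)$ with $r_1=0$, $z_j=(x_j+y_j+r_j)\bmod\alpha_j$, and for $j\ge2$, $r_j=0$ if $x_{j-1}+y_{j-1}+r_{j-1}<\alpha_{j-1}$ and $r_j=1$ otherwise. The odometer is $T_\alpha(x)=x+(1,0,0,\ldots)$, a minimal homeomorphism of a Cantor space. A homeomorphism is minimal if all its orbits are dense. *)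

theory Defs
  imports "HOL-Analysis.Analysis"
begin

text \<open>
  Dynamical systems live on the carrier \<^term>\<open>topspace X\<close> of an abstract topology; values of
  maps outside the carrier are irrelevant.  Hence the inverse is taken relative to the carrier.
\<close>

definition int_iterate :: "'a set \<Rightarrow> ('a \<Rightarrow> 'a) \<Rightarrow> int \<Rightarrow> 'a \<Rightarrow> 'a" where
  "int_iterate A f n =
     (if n \<ge> 0 then f ^^ nat n else inv_into A f ^^ nat (- n))"

definition orbit_of :: "'a set \<Rightarrow> ('a \<Rightarrow> 'a) \<Rightarrow> 'a \<Rightarrow> 'a set" where
  "orbit_of A f x = range (\<lambda>n. int_iterate A f n x)"

definition minimal_homeo :: "'a topology \<Rightarrow> ('a \<Rightarrow> 'a) \<Rightarrow> bool" where
  "minimal_homeo X f \<longleftrightarrow>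
     homeomorphic_map X X f \<and>
     (\<forall>x\<in>topspace X. X closure_of (orbit_of (topspace X) f x) = topspace X)"

definition bounded_speedup :: "'a topology \<Rightarrow> ('a \<Rightarrow> 'a) \<Rightarrow> ('a \<Rightarrow> 'a) \<Rightarrow> bool" where
  "bounded_speedup X T S \<longleftrightarrow>
     homeomorphic_map X X S \<and>
     (\<exists>p :: 'a \<Rightarrow> nat.
        (\<forall>x\<in>topspace X. p x \<ge> 1) \<and>
        (\<exists>M. \<forall>x\<in>topspace X. p x \<le> M) \<and>
        (\<forall>x\<in>topspace X. S x = (T ^^ p x) x))"

definition has_orbit_number ::
    "'a topology \<Rightarrow> ('a \<Rightarrow> 'a) \<Rightarrow> ('a \<Rightarrow> 'a) \<Rightarrow> nat \<Rightarrow> bool" where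
  "has_orbit_number X T S c \<longleftrightarrow>
     (\<forall>x\<in>topspace X. \<exists>F. F \<subseteq> orbit_of (topspace X) S ` topspace X \<and>
        finite F \<and> card F = c \<and> orbit_of (topspace X) T x = \<Union>F)"

text \<open>
  Sequences are indexed from 0, so \<^term>\<open>\<alpha> i\<close> below is $\alpha_{i+1}$ in the usual 1-based
  notation for odometers.
\<close>

definition odometer_space :: "(nat \<Rightarrow> nat) \<Rightarrow> (nat \<Rightarrow> nat) topology" where
  "odometer_space \<alpha> = product_topology (\<lambda>i. discrete_topology {0..<\<alpha> i}) UNIV"

primrec odometer_carry :: "(nat \<Rightarrow> nat) \<Rightarrow> (nat \<Rightarrow> nat) \<Rightarrow> (nat \<Rightarrow> nat) \<Rightarrow> nat \<Rightarrow> nat" where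
  "odometer_carry \<alpha> x y 0 = 0"
| "odometer_carry \<alpha> x y (Suc j) =
     (if x j + y j + odometer_carry \<alpha> x y j < \<alpha> j then 0 else 1)"

definition odometer_add ::
    "(nat \<Rightarrow> nat) \<Rightarrow> (nat \<Rightarrow> nat) \<Rightarrow> (nat \<Rightarrow> nat) \<Rightarrow> (nat \<Rightarrow> nat)" where
  "odometer_add \<alpha> x y = (\<lambda>j. (x j + y j + odometer_carry \<alpha> x y j) mod \<alpha> j)"

definition odometer :: "(nat \<Rightarrow> nat) \<Rightarrow> (nat \<Rightarrow> nat) \<Rightarrow> (nat \<Rightarrow> nat)" where
  "odometer \<alpha> x = odometer_add \<alpha> x (\<lambda>i. if i = 0 then 1 else 0)"

end

theory Submission
  imports Defs "HOL-Number_Theory.Cong"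
begin

text \<open>
  The first \<open>n\<close> digits of a point \<open>x\<close> are the mixed-radix expansion of an integer modulo
  $P_n = \alpha_0 \cdots \alpha_{n-1}$, called \<open>residue n x\<close> below (and \<open>weight n\<close> is $P_n$).
  In these coordinates the odometer is \<open>+ 1\<close> modulo every $P_n$ at once, so it extends to an action
  \<open>shift\<close> of the integers, which is free because $P_n$ is unbounded.  Two points are close exactly
  when they have the same residue modulo a large $P_n$.

  If \<open>c\<close> is coprime to every digit base, then the \<open>c\<close>-th power of the odometer is already the
  desired speedup: it is minimal because \<open>c\<close> is invertible modulo every $P_n$, and it cuts each
  orbit into the \<open>c\<close> classes modulo \<open>c\<close>.  In general only the bases from position \<open>N\<close> on are
  coprime to \<open>c\<close>.  Put $A = P_N$ and view the space as a tower of height \<open>A\<close>, the level of \<open>x\<close>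
  being \<open>residue N x\<close>; the return map of the odometer to the bottom level is again an odometer, with
  bases $\alpha_N, \alpha_{N+1}, \ldots$.  The speedup climbs the tower one level at a time, and
  from the top level it returns to the bottom level after $c - 1$ extra passes through the tower.
  Its return map to the bottom level is then the \<open>c\<close>-th power of an odometer whose bases are coprime
  to \<open>c\<close>, which is the easy case, and one climb of the tower transports both
  minimality (lemma \<open>minimal_homeo_speedup\<close>) and the number of orbits
  (lemma \<open>has_orbit_number_speedup\<close>) from the bottom level to the whole space.

  Concretely, along the orbit of a bottom point the speedup is a map of the integers, and it preserves
  the class modulo \<open>c\<close> of the block of length \<open>A\<close> that contains a given integer.  The function
  \<open>strand j\<close> enumerates class \<open>j\<close> in increasing order and turns the speedup into
  \<open>t \<mapsto> t + 1\<close>; both orbit statements are read off from it.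
\<close>

section \<open>Orbits parametrised by the integers\<close>

text \<open>
  Orbits are defined with the relative inverse \<open>inv_into\<close>.  Exhibiting a two-sided sequence that \<open>f\<close>
  advances by one step determines the orbit without computing that inverse.
\<close>
lemma orbit_of_eq_range:
  fixes g :: "int \<Rightarrow> 'a"
  assumes inj: "inj_on f A" and g: "\<And>t. g t \<in> A" and step: "\<And>t. f (g t) = g (t + 1)"
  shows "orbit_of A f (g t) = range g"
proof -
  have fwd: "(f ^^ n) (g t) = g (t + int n)" for n
    by (induction n) (auto simp: step algebra_simps)
  have inv: "inv_into A f (g t) = g (t - 1)" for t
    using inv_into_f_f[OF inj g[of "t - 1"]] by (simp add: step)
  have bwd: "(inv_into A f ^^ n) (g t) = g (t - int n)" for n
    by (induction n) (auto simp: inv algebra_simps)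
  have "int_iterate A f n (g t) = g (t + n)" for n
    by (simp add: int_iterate_def fwd bwd)
  moreover have "range (\<lambda>n. g (t + n)) = range g"
  proof -
    have "g s \<in> range (\<lambda>n. g (t + n))" for s
      by (rule range_eqI[where x = "s - t"]) simp
    then show ?thesis by auto
  qed
  ultimately show ?thesis
    by (simp add: orbit_of_def)
qed

section \<open>Residues of odometer points\<close>

locale odometer_digits =
  fixes \<alpha> :: "nat \<Rightarrow> nat"
  assumes base_ge_2: "\<alpha> i \<ge> 2"
begin

abbreviation X :: "(nat \<Rightarrow> nat) set" where
  "X \<equiv> topspace (odometer_space \<alpha>)"

definition weight :: "nat \<Rightarrow> int" where
  "weight n = (\<Prod>i<n. int (\<alpha> i))"

definition residue :: "nat \<Rightarrow> (nat \<Rightarrow> nat) \<Rightarrow> int" where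
  "residue n x = (\<Sum>i<n. int (x i) * weight i)"

lemma X_iff: "x \<in> X \<longleftrightarrow> (\<forall>i. x i < \<alpha> i)"
  by (auto simp: odometer_space_def PiE_iff)

lemma weight_0 [simp]: "weight 0 = 1" and weight_Suc: "weight (Suc n) = weight n * int (\<alpha> n)"
  by (simp_all add: weight_def)

lemma residue_0 [simp]: "residue 0 x = 0"
  and residue_Suc: "residue (Suc n) x = residue n x + int (x n) * weight n"
  by (simp_all add: residue_def)

lemma base_pos: "0 < \<alpha> i" and base_gt_1: "1 < \<alpha> i"
  using base_ge_2[of i] by simp_all

lemma weight_pos [simp]: "weight n > 0"
  by (simp add: weight_def prod_pos base_pos)

lemma weight_ge: "weight n \<ge> 2 ^ n"
proof (induction n)
  case (Suc n)
  have "weight n * int (\<alpha> n) \<ge> 2 ^ n * 2"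
    using Suc base_ge_2[of n] by (intro mult_mono) (auto simp: less_imp_le)
  then show ?case by (simp add: weight_Suc)
qed simp

lemma weight_nonzero [simp]: "weight n \<noteq> 0"
  using weight_pos[of n] by linarith

lemma weight_dvd: "m \<le> n \<Longrightarrow> weight m dvd weight n"
  by (induction n rule: dec_induct) (auto simp: weight_Suc)

lemma weight_unbounded: "\<exists>n. weight n > k"
proof -
  have "k < 2 ^ nat k"
    using of_nat_less_two_power[of "nat k", where 'a = int] by linarith
  then show ?thesis
    using weight_ge[of "nat k"] order.strict_trans2 by blast
qed

lemma residue_bounds:
  assumes "x \<in> X" shows "0 \<le> residue n x" "residue n x < weight n"
proof -
  have "0 \<le> residue n x \<and> residue n x < weight n"
  proof (induction n)
    case (Suc n)
    have "x n < \<alpha> n"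
      using assms by (simp add: X_iff)
    then have "(int (x n) + 1) * weight n \<le> int (\<alpha> n) * weight n"
      by (intro mult_right_mono) (simp_all add: less_imp_le)
    moreover have "0 \<le> int (x n) * weight n"
      by (simp add: less_imp_le)
    ultimately show ?case
      using Suc by (simp add: residue_Suc weight_Suc algebra_simps)
  qed simp
  then show "0 \<le> residue n x" "residue n x < weight n" by auto
qed

text \<open>The residues of a point form a coherent sequence, that is, an element of the inverse limit of
  the rings of integers modulo \<open>weight n\<close>.\<close>
lemma residue_mod:
  assumes "x \<in> X" "m \<le> n" shows "residue n x mod weight m = residue m x"
  using assms(2)
proof (induction n rule: dec_induct)
  case base
  then show ?case using residue_bounds[OF assms(1)] by simp
next
  case (step n)
  have "weight m dvd int (x n) * weight n"
    using step weight_dvd by simp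
  then show ?case
    using step by (metis residue_Suc dvd_imp_mod_0 mod_add_right_eq add.right_neutral)
qed

lemma residue_eq_iff:
  assumes "x \<in> X" "y \<in> X"
  shows "residue n x = residue n y \<longleftrightarrow> (\<forall>i<n. x i = y i)"
proof (induction n)
  case (Suc n)
  have "residue n x = residue n y" if "residue (Suc n) x = residue (Suc n) y"
    using that residue_mod[OF assms(1), of n "Suc n"] residue_mod[OF assms(2), of n "Suc n"] by simp
  then show ?case
    using Suc weight_pos[of n] by (auto simp: residue_Suc less_Suc_eq)
qed simp

lemma residue_ext:
  assumes "x \<in> X" "y \<in> X" "\<And>n. residue n x = residue n y"
  shows "x = y"
  using assms residue_eq_iff by blast

section \<open>The integer action of the odometer\<close>

text \<open>
  The digit at position \<open>i\<close> is read off from the residue modulo \<open>weight (Suc i)\<close> that the translate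
  should have.  This avoids any discussion of carries and treats negative \<open>k\<close> on the same footing.
\<close>
definition shift :: "int \<Rightarrow> (nat \<Rightarrow> nat) \<Rightarrow> (nat \<Rightarrow> nat)" where
  "shift k x = (\<lambda>i. nat ((residue (Suc i) x + k) mod weight (Suc i) div weight i))"

lemma shift_digit:
  "int (shift k x i) = (residue (Suc i) x + k) mod weight (Suc i) div weight i"
  using pos_imp_zdiv_nonneg_iff[OF weight_pos[of i]] by (simp add: shift_def)

lemma shift_in_X [simp]: "shift k x \<in> X"
proof -
  have "int (shift k x i) < int (\<alpha> i)" for i
  proof -
    let ?z = "(residue (Suc i) x + k) mod weight (Suc i)"
    have "weight i * (?z div weight i) \<le> ?z"
      using mult_div_mod_eq[of "weight i" ?z] pos_mod_sign[OF weight_pos[of i], of ?z] by linarith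
    also have "?z < weight i * int (\<alpha> i)"
      using pos_mod_bound[OF weight_pos[of "Suc i"]] by (simp only: weight_Suc)
    finally show ?thesis
      by (simp only: shift_digit mult_less_cancel_left_pos[OF weight_pos])
  qed
  then show ?thesis by (auto simp: X_iff)
qed

text \<open>
  The digits of \<open>shift k x\<close> were extracted from the integers \<open>residue n x + k\<close> reduced modulo
  \<open>weight n\<close>.  These are coherent in \<open>n\<close>, so the digits below \<open>n\<close> reassemble to the \<open>n\<close>-th of them.
\<close>
lemma residue_shift:
  assumes "x \<in> X" shows "residue n (shift k x) = (residue n x + k) mod weight n"
proof (induction n)
  case (Suc n)
  let ?z = "(residue (Suc n) x + k) mod weight (Suc n)"
  have "?z mod weight n = (residue (Suc n) x + k) mod weight n"
    by (rule mod_mod_cancel) (simp add: weight_Suc)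
  also have "\<dots> = (residue n x + k) mod weight n"
    using residue_mod[OF assms, of n "Suc n"] by (metis mod_add_left_eq le_SucI order_refl)
  finally have "residue n (shift k x) = ?z mod weight n"
    using Suc by simp
  then show ?case
    by (simp only: residue_Suc[of n "shift k x"] shift_digit mod_mult_div_eq add.commute mult.commute)
qed simp

lemma shift_shift:
  assumes "x \<in> X" shows "shift k (shift l x) = shift (l + k) x"
  by (rule residue_ext) (simp_all add: assms residue_shift mod_simps add.assoc)

lemma shift_0: "x \<in> X \<Longrightarrow> shift 0 x = x"
  by (rule residue_ext) (simp_all add: residue_shift residue_bounds)

text \<open>The action is free: the difference of two times with the same effect is divisible by every
  \<open>weight n\<close>, and these are unbounded.\<close>
lemma shift_inject:
  assumes "x \<in> X" "shift k x = shift l x" shows "k = l"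
proof -
  obtain n where n: "weight n > \<bar>k - l\<bar>"
    using weight_unbounded by blast
  have "(residue n x + k) mod weight n = (residue n x + l) mod weight n"
    using assms by (metis residue_shift)
  then have "weight n dvd (residue n x + k) - (residue n x + l)"
    by (simp only: mod_eq_dvd_iff)
  then have "weight n dvd k - l" by simp
  then show ?thesis
    using n dvd_imp_le_int[of "k - l" "weight n"] weight_pos[of n] by force
qed

text \<open>Addition with carrying loses only the carry out of position \<open>n - 1\<close>, which is worth
  \<open>weight n\<close>; hence it is addition of residues modulo \<open>weight n\<close>.\<close>
lemma residue_add_carry:
  assumes "x \<in> X" "y \<in> X"
  shows "residue n (odometer_add \<alpha> x y) + weight n * int (odometer_carry \<alpha> x y n)
    = residue n x + residue n y"
proof (induction n)
  case (Suc n)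
  let ?r = "odometer_carry \<alpha> x y n"
  let ?s = "x n + y n + ?r"
  have r: "?r \<le> 1" by (cases n) auto
  have "x n < \<alpha> n" "y n < \<alpha> n" using assms by (auto simp: X_iff)
  then have "?s < 2 * \<alpha> n" using r by linarith
  then have "?s mod \<alpha> n + \<alpha> n * odometer_carry \<alpha> x y (Suc n) = ?s"
    by (auto simp: mod_if)
  then have "int (odometer_add \<alpha> x y n) + int (\<alpha> n) * int (odometer_carry \<alpha> x y (Suc n)) = int ?s"
    unfolding odometer_add_def by (metis of_nat_add of_nat_mult)
  then have "weight n * (int (odometer_add \<alpha> x y n)
      + int (\<alpha> n) * int (odometer_carry \<alpha> x y (Suc n))) = weight n * int ?s"
    by simp
  then show ?case
    using Suc by (simp add: residue_Suc weight_Suc algebra_simps del: odometer_carry.simps)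
qed simp

lemma odometer_eq_shift:
  assumes x: "x \<in> X" shows "odometer \<alpha> x = shift 1 x"
proof (rule residue_ext)
  let ?e = "\<lambda>i::nat. if i = 0 then 1 else 0 :: nat"
  have e: "?e \<in> X"
    using base_pos base_gt_1 by (auto simp: X_iff)
  show T: "odometer \<alpha> x \<in> X"
    using base_pos by (simp add: X_iff odometer_def odometer_add_def)
  fix n
  show "residue n (odometer \<alpha> x) = residue n (shift 1 x)"
  proof (cases n)
    case (Suc m)
    have one: "residue n ?e = 1"
      unfolding Suc by (induction m) (auto simp: residue_Suc)
    have "residue n (odometer \<alpha> x) + weight n * int (odometer_carry \<alpha> x ?e n) = residue n x + 1"
      using residue_add_carry[OF x e, of n] one by (simp add: odometer_def)
    then have "residue n (odometer \<alpha> x) mod weight n = (residue n x + 1) mod weight n"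
      by (metis mod_mult_self2)
    then show ?thesis
      using residue_bounds[OF T] x by (simp add: residue_shift)
  qed simp
qed simp

lemma odometer_funpow: "x \<in> X \<Longrightarrow> (odometer \<alpha> ^^ n) x = shift (int n) x"
  by (induction n) (simp_all add: shift_0 odometer_eq_shift shift_shift add.commute)

lemma orbit_of_odometer:
  assumes "x \<in> X" shows "orbit_of X (odometer \<alpha>) x = range (\<lambda>k. shift k x)"
proof -
  have "inj_on (odometer \<alpha>) X"
    by (rule inj_on_inverseI[where g = "shift (- 1)"])
      (simp add: odometer_eq_shift shift_shift shift_0)
  then have "orbit_of X (odometer \<alpha>) (shift 0 x) = range (\<lambda>k. shift k x)"
    by (rule orbit_of_eq_range) (simp_all add: assms odometer_eq_shift shift_shift)
  then show ?thesis by (simp add: shift_0 assms)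
qed

section \<open>Topology through residues\<close>

text \<open>This lemma and the next say that the sets of points with a prescribed residue are a basis of
  the topology, since a residue encodes finitely many digits.\<close>
lemma residue_nhds:
  assumes U: "openin (odometer_space \<alpha>) U" and x: "x \<in> U"
  obtains n where "\<And>y. y \<in> X \<Longrightarrow> residue n y = residue n x \<Longrightarrow> y \<in> U"
proof -
  obtain V where V: "finite {i. V i \<noteq> {0..<\<alpha> i}}" "x \<in> PiE UNIV V" "PiE UNIV V \<subseteq> U"
    using U x unfolding odometer_space_def openin_product_topology_alt by auto
  obtain n where n: "\<And>i. V i \<noteq> {0..<\<alpha> i} \<Longrightarrow> i < n"
    using finite_nat_set_iff_bounded V(1) by auto
  have xX: "x \<in> X" using U x openin_subset by blast
  show thesis
  proof
    fix y assume y: "y \<in> X" "residue n y = residue n x"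
    have "y i \<in> V i" for i
    proof (cases "i < n")
      case True
      then have "y i = x i" using y xX residue_eq_iff by blast
      then show ?thesis using V(2) by (auto simp: PiE_iff)
    next
      case False
      then have "V i = {0..<\<alpha> i}" using n by blast
      then show ?thesis using y(1) by (simp add: X_iff)
    qed
    then show "y \<in> U" using V(3) by (auto simp: PiE_iff)
  qed
qed

lemma openin_cylinder:
  assumes x: "x \<in> X" shows "openin (odometer_space \<alpha>) {y \<in> X. residue n y = residue n x}"
proof -
  let ?V = "\<lambda>i. if i < n then {x i} else {0..<\<alpha> i}"
  have eq: "{y \<in> X. residue n y = residue n x} = PiE UNIV ?V"
  proof (intro equalityI subsetI)
    fix y assume "y \<in> {y \<in> X. residue n y = residue n x}"
    then show "y \<in> PiE UNIV ?V"
      using x residue_eq_iff[of y x n] by (auto simp: X_iff)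
  next
    fix y assume "y \<in> PiE UNIV ?V"
    then have y: "y i \<in> ?V i" for i by (auto simp: PiE_iff)
    have "y i < \<alpha> i" for i
      using y[of i] x by (cases "i < n") (auto simp: X_iff)
    then have yX: "y \<in> X" by (simp add: X_iff)
    have "y i = x i" if "i < n" for i
      using y[of i] that by simp
    then show "y \<in> {y \<in> X. residue n y = residue n x}"
      using residue_eq_iff[OF yX x] yX by simp
  qed
  have "finite {i. ?V i \<noteq> {0..<\<alpha> i}}"
    by (rule finite_subset[of _ "{..<n}"]) auto
  then show ?thesis
    unfolding eq unfolding odometer_space_def openin_PiE_gen
    using x by (auto simp: X_iff)
qed

lemma continuous_map_residueI:
  assumes f: "f ` X \<subseteq> X"
    and det: "\<And>n. \<exists>m. \<forall>x\<in>X. \<forall>y\<in>X. residue m x = residue m y \<longrightarrow> residue n (f x) = residue n (f y)"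
  shows "continuous_map (odometer_space \<alpha>) (odometer_space \<alpha>) f"
  unfolding continuous_map_def
proof (intro conjI allI impI)
  fix U assume U: "openin (odometer_space \<alpha>) U"
  show "openin (odometer_space \<alpha>) {x \<in> X. f x \<in> U}"
  proof (subst openin_subopen, intro ballI)
    fix x assume x: "x \<in> {x \<in> X. f x \<in> U}"
    obtain n where n: "\<And>y. y \<in> X \<Longrightarrow> residue n y = residue n (f x) \<Longrightarrow> y \<in> U"
      using residue_nhds[OF U] x by blast
    obtain m where m: "\<forall>x\<in>X. \<forall>y\<in>X. residue m x = residue m y \<longrightarrow> residue n (f x) = residue n (f y)"
      using det by blast
    have "{y \<in> X. residue m y = residue m x} \<subseteq> {x \<in> X. f x \<in> U}"
      using n m f x by blast
    then show "\<exists>T. openin (odometer_space \<alpha>) T \<and> x \<in> T \<and> T \<subseteq> {x \<in> X. f x \<in> U}"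
      using openin_cylinder[of x m] x by blast
  qed
qed (use f in auto)

text \<open>Translating by a locally constant amount is continuous; both the speedup and its inverse have
  this form.\<close>
lemma continuous_map_variable_shift:
  assumes g: "\<And>x y. residue N x = residue N y \<Longrightarrow> g x = g y"
  shows "continuous_map (odometer_space \<alpha>) (odometer_space \<alpha>) (\<lambda>x. shift (g x) x)"
proof (rule continuous_map_residueI)
  fix n
  have "residue n (shift (g x) x) = residue n (shift (g y) y)"
    if "x \<in> X" "y \<in> X" "residue (max n N) x = residue (max n N) y" for x y
  proof -
    have "residue n x = residue n y" "residue N x = residue N y"
      using that by (metis residue_mod max.cobounded1, metis residue_mod max.cobounded2)
    with g[OF this(2)] that show ?thesis by (simp add: residue_shift)
  qed
  then show "\<exists>m. \<forall>x\<in>X. \<forall>y\<in>X. residue m x = residue m y \<longrightarrow>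
      residue n (shift (g x) x) = residue n (shift (g y) y)"
    by blast
qed auto

end

section \<open>The speedup\<close>

locale odometer_speedup = odometer_digits +
  fixes c N :: nat
  assumes c_ge_1: "c \<ge> 1" and coprime_tail: "i \<ge> N \<Longrightarrow> gcd c (\<alpha> i) = 1"
begin

text \<open>One step to the next level, followed by \<open>c - 1\<close> further passes through the tower of height
  \<open>weight N\<close>.\<close>
definition leap :: int where
  "leap = weight N * (int c - 1) + 1"

definition time :: "(nat \<Rightarrow> nat) \<Rightarrow> int" where
  "time x = (if residue N x = weight N - 1 then leap else 1)"

text \<open>The time of the step that arrives at \<open>x\<close>: the bottom level is entered only from the
  top.\<close>
definition back_time :: "(nat \<Rightarrow> nat) \<Rightarrow> int" where
  "back_time x = (if residue N x = 0 then leap else 1)"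

definition speedup :: "(nat \<Rightarrow> nat) \<Rightarrow> (nat \<Rightarrow> nat)" where
  "speedup x = shift (time x) x"

lemma leap_ge_1: "leap \<ge> 1"
  using c_ge_1 by (simp add: leap_def less_imp_le)

text \<open>Modulo \<open>weight N\<close> every step of the speedup is a step of the odometer, because a leap differs
  from it by full passes.\<close>
lemma time_cong: "time x mod weight N = 1 mod weight N"
  and back_time_cong: "back_time x mod weight N = 1 mod weight N"
  by (simp_all add: time_def back_time_def leap_def)

lemma residue_shift_time:
  assumes "x \<in> X" shows "residue N (shift (time x) x) = (residue N x + 1) mod weight N"
  using assms time_cong[of x] by (metis residue_shift mod_add_right_eq)

lemma residue_shift_back_time:
  assumes "x \<in> X" shows "residue N (shift (- back_time x) x) = (residue N x - 1) mod weight N"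
  using assms back_time_cong[of x] by (metis residue_shift mod_diff_right_eq uminus_add_conv_diff add.commute)

text \<open>The level after a step determines the level before it, so the step can be undone: \<open>back_time\<close>
  at the new point is \<open>time\<close> at the old one, and conversely.\<close>
lemma homeomorphic_maps_speedup:
  "homeomorphic_maps (odometer_space \<alpha>) (odometer_space \<alpha>) speedup (\<lambda>x. shift (- back_time x) x)"
  unfolding homeomorphic_maps_def
proof (intro conjI ballI)
  show "continuous_map (odometer_space \<alpha>) (odometer_space \<alpha>) speedup"
    unfolding speedup_def[abs_def]
    by (rule continuous_map_variable_shift[of N]) (simp add: time_def)
  show "continuous_map (odometer_space \<alpha>) (odometer_space \<alpha>) (\<lambda>x. shift (- back_time x) x)"
    by (rule continuous_map_variable_shift[of N]) (simp add: back_time_def)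
next
  fix x assume x: "x \<in> X"
  have "(residue N x + 1) mod weight N = 0 \<longleftrightarrow> residue N x = weight N - 1"
    using residue_bounds[OF x, of N]
    by (cases "residue N x + 1 = weight N") auto
  then have "back_time (shift (time x) x) = time x"
    using x by (simp add: back_time_def residue_shift_time) (simp add: time_def)
  then show "shift (- back_time (speedup x)) (speedup x) = x"
    using x by (simp add: speedup_def shift_shift shift_0)
next
  fix x assume x: "x \<in> X"
  have "(residue N x - 1) mod weight N = weight N - 1 \<longleftrightarrow> residue N x = 0"
    using residue_bounds[OF x, of N] 
    by (cases "residue N x = 0") (auto simp: zmod_minus1)
  then have "time (shift (- back_time x) x) = back_time x"
    using x by (simp add: time_def residue_shift_back_time) (simp add: back_time_def)
  then show "speedup (shift (- back_time x) x) = x"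
    using x by (simp add: speedup_def shift_shift shift_0)
qed

lemma homeomorphic_map_speedup: "homeomorphic_map (odometer_space \<alpha>) (odometer_space \<alpha>) speedup"
  using homeomorphic_maps_speedup homeomorphic_map_maps by blast

lemma bounded_speedup_speedup: "bounded_speedup (odometer_space \<alpha>) (odometer \<alpha>) speedup"
  unfolding bounded_speedup_def
proof (intro conjI exI[of _ "\<lambda>x. nat (time x)"] exI[of _ "nat leap"] ballI homeomorphic_map_speedup)
  fix x assume x: "x \<in> X"
  have t: "1 \<le> time x" "time x \<le> leap" using leap_ge_1 by (auto simp: time_def)
  then show "1 \<le> nat (time x)" "nat (time x) \<le> nat leap" by auto
  show "speedup x = (odometer \<alpha> ^^ nat (time x)) x"
    using t x by (simp add: odometer_funpow speedup_def)
qed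

text \<open>
  The integers are divided into blocks of length \<open>weight N\<close>, numbered by \<open>k div weight N\<close>.  For
  \<open>0 \<le> j < c\<close>, \<open>strand j\<close> lists in order the integers in the blocks whose number is congruent to \<open>j\<close>
  modulo \<open>c\<close>.
\<close>
definition strand :: "int \<Rightarrow> int \<Rightarrow> int" where
  "strand j t = weight N * (int c * (t div weight N) + j) + t mod weight N"

lemma strand_block:
  assumes "0 \<le> r" "r < weight N"
  shows "strand j (weight N * q + r) = weight N * (int c * q + j) + r"
  using assms by (simp add: strand_def)

text \<open>Inside a block, consecutive elements of a strand differ by 1; from the end of a block to the
  start of the next block of the strand the gap is a leap.  As \<open>x\<close> lies in the bottom level,
  the level of a translate of \<open>x\<close> is the position of the time in its block.\<close>
lemma speedup_strand:
  assumes x: "x \<in> X" and base: "residue N x = 0"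
  shows "speedup (shift (strand j t) x) = shift (strand j (t + 1)) x"
proof -
  define q r where "q = t div weight N" and "r = t mod weight N"
  have t: "t = weight N * q + r" and r: "0 \<le> r" "r < weight N"
    by (simp_all add: q_def r_def)
  have res: "residue N (shift (strand j t) x) = r"
    using r by (simp add: residue_shift x base strand_block t)
  have st: "strand j t = weight N * (int c * q + j) + r"
    unfolding t using r by (rule strand_block)
  have "strand j (t + 1) = strand j t + time (shift (strand j t) x)"
  proof (cases "r = weight N - 1")
    case True
    then have "t + 1 = weight N * (q + 1) + 0" by (simp add: t algebra_simps)
    then have "strand j (t + 1) = weight N * (int c * (q + 1) + j)"
      using strand_block[of 0 j "q + 1"] by simp
    then show ?thesis
      unfolding time_def res unfolding st using True
      by (simp add: leap_def algebra_simps)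
  next
    case False
    then have "strand j (weight N * q + (r + 1)) = weight N * (int c * q + j) + (r + 1)"
      using r by (intro strand_block) auto
    then show ?thesis
      unfolding time_def res unfolding st using False by (simp add: t add.assoc)
  qed
  then show ?thesis using x by (simp add: speedup_def shift_shift)
qed

lemma orbit_of_speedup:
  assumes x: "x \<in> X" and base: "residue N x = 0"
  shows "orbit_of X speedup (shift (strand j t) x) = range (\<lambda>t. shift (strand j t) x)"
proof (rule orbit_of_eq_range[where g = "\<lambda>t. shift (strand j t) x"])
  show "inj_on speedup X"
    using homeomorphic_map_speedup by (simp add: homeomorphic_eq_everything_map)
qed (simp_all add: speedup_strand x base)

lemma strand_index:
  assumes "0 \<le> j" "j < int c"
  shows "strand j t div weight N mod int c = j"
  using assms by (simp add: strand_def)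

lemma strand_cover:
  obtains j t where "0 \<le> j" "j < int c" "k = strand j t"
proof
  let ?q = "k div weight N"
  show "0 \<le> ?q mod int c" "?q mod int c < int c"
    using c_ge_1 by simp_all
  show "k = strand (?q mod int c) (weight N * (?q div int c) + k mod weight N)"
    by (subst strand_block) simp_all
qed

text \<open>Every point lies above a point of the bottom level, on the same odometer orbit.\<close>
lemma base_point:
  assumes "x \<in> X"
  obtains y r where "y \<in> X" "residue N y = 0" "x = shift r y" "0 \<le> r" "r < weight N"
proof
  let ?y = "shift (- residue N x) x"
  show "residue N ?y = 0" "x = shift (residue N x) ?y"
    by (simp_all add: assms residue_shift shift_shift shift_0)
qed (simp_all add: assms residue_bounds)

text \<open>The \<open>c\<close> strands partition the integers, and freeness of the action carries this partition over
  to the odometer orbit.\<close>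
lemma has_orbit_number_speedup: "has_orbit_number (odometer_space \<alpha>) (odometer \<alpha>) speedup c"
  unfolding has_orbit_number_def
proof
  fix x assume "x \<in> X"
  \<comment> \<open>The strands describe speedup orbits only relative to a point of the bottom level.\<close>
  then obtain y r where y: "y \<in> X" "residue N y = 0" and x: "x = shift r y"
    by (rule base_point)
  let ?orb = "\<lambda>j. range (\<lambda>t. shift (strand j t) y)"
  let ?F = "?orb ` {0..<int c}"
  have orb: "?orb j \<in> orbit_of X speedup ` X" for j
    using orbit_of_speedup[OF y, of j 0] by (metis imageI shift_in_X)
  have "inj_on ?orb {0..<int c}"
  proof (rule inj_onI)
    fix i j assume ij: "i \<in> {0..<int c}" "j \<in> {0..<int c}" "?orb i = ?orb j"
    then obtain t where "shift (strand i 0) y = shift (strand j t) y" by blast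
    then have "strand i 0 = strand j t" using shift_inject y by blast
    then show "i = j" using ij strand_index by (metis atLeastLessThan_iff)
  qed
  then have card: "card ?F = c" by (simp add: card_image)
  have "orbit_of X (odometer \<alpha>) x = range (\<lambda>k. shift k y)"
  proof -
    have "orbit_of X (odometer \<alpha>) x = range (\<lambda>k. shift (r + k) y)"
      by (simp add: x orbit_of_odometer shift_shift y)
    moreover have "shift k y \<in> range (\<lambda>k. shift (r + k) y)" for k
      by (rule range_eqI[where x = "k - r"]) simp
    ultimately show ?thesis by auto
  qed
  also have "\<dots> = \<Union>?F"
  proof (intro equalityI subsetI)
    fix z assume "z \<in> range (\<lambda>k. shift k y)"
    then obtain k where z: "z = shift k y" by blast
    obtain j t where "0 \<le> j" "j < int c" "k = strand j t" by (rule strand_cover)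
    then have "z \<in> ?orb j" "j \<in> {0..<int c}" using z by auto
    then show "z \<in> \<Union>?F" by blast
  qed auto
  finally show "\<exists>F\<subseteq>orbit_of X speedup ` X. finite F \<and> card F = c \<and> orbit_of X (odometer \<alpha>) x = \<Union>F"
    using orb card by (intro exI[of _ ?F]) auto
qed

lemma weight_tail:
  assumes "N \<le> n" obtains Q where "weight n = weight N * Q" "coprime (int c) Q"
proof
  show "weight n = weight N * (\<Prod>i=N..<n. int (\<alpha> i))"
    unfolding weight_def using assms prod.atLeastLessThan_concat[of 0 N n "\<lambda>i. int (\<alpha> i)"]
    by (simp add: atLeast0LessThan)
  show "coprime (int c) (\<Prod>i=N..<n. int (\<alpha> i))"
    using coprime_tail by (intro prod_coprime_right) (auto simp: coprime_iff_gcd_eq_1)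
qed

text \<open>
  Within a strand, moving up by one block of the strand adds \<open>c\<close> times \<open>weight N\<close>.  Since
  \<open>weight m\<close> is \<open>weight N\<close> times a number \<open>Q\<close> coprime to \<open>c\<close>, such moves reach every block modulo \<open>Q\<close>,
  and the position inside the block is free.
\<close>
lemma strand_hits_residue:
  assumes y: "y \<in> X" "residue N y = 0" and z: "z \<in> X"
  obtains t where "residue n (shift (strand 0 t) y) = residue n z"
proof -
  \<comment> \<open>Prescribing a finer residue is harmless, and the level must be part of it.\<close>
  define m where "m = max n N"
  obtain Q where Q: "weight m = weight N * Q" "coprime (int c) Q"
    using weight_tail[of m] by (auto simp: m_def)
  define a b r where "a = residue m y div weight N" and "b = residue m z div weight N"
    and "r = residue m z mod weight N"
  have ym: "residue m y = weight N * a"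
    using residue_mod[OF y(1), of N m] y(2) by (auto simp: m_def a_def)
  have zm: "residue m z = weight N * b + r" by (simp add: b_def r_def)
  obtain u where "[int c * u = 1] (mod Q)"
    using cong_solve_coprime_int Q(2) by blast
  then have "[int c * u * (b - a) = 1 * (b - a)] (mod Q)"
    by (rule cong_scalar_right)
  then have "Q dvd int c * u * (b - a) - 1 * (b - a)"
    by (simp only: cong_iff_dvd_diff)
  then have dvd: "weight m dvd weight N * (int c * u * (b - a) - 1 * (b - a))"
    by (simp add: Q(1))
  \<comment> \<open>With \<open>u\<close> inverse to \<open>c\<close>, this goes from block \<open>a\<close> to block \<open>b\<close>, at height \<open>r\<close>.\<close>
  define t where "t = weight N * (u * (b - a)) + r"
  have "strand 0 t = weight N * (int c * (u * (b - a)) + 0) + r"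
    unfolding t_def by (rule strand_block) (simp_all add: r_def)
  then have "residue m y + strand 0 t - residue m z = weight N * (int c * u * (b - a) - 1 * (b - a))"
    by (simp add: ym zm algebra_simps)
  with dvd have "(residue m y + strand 0 t) mod weight m = residue m z mod weight m"
    by (simp add: mod_eq_dvd_iff)
  then have "residue m (shift (strand 0 t) y) = residue m z"
    using residue_bounds[OF z] by (simp add: residue_shift y)
  then have "residue n (shift (strand 0 t) y) = residue n z"
    using residue_mod[of _ n m] z by (metis m_def max.cobounded1 shift_in_X)
  then show thesis by (rule that)
qed

lemma minimal_homeo_speedup: "minimal_homeo (odometer_space \<alpha>) speedup"
  unfolding minimal_homeo_def
proof (intro conjI ballI homeomorphic_map_speedup)
  fix x assume "x \<in> X"
  then obtain y r where y: "y \<in> X" "residue N y = 0" and x: "x = shift r y" "0 \<le> r" "r < weight N"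
    by (rule base_point)
  \<comment> \<open>As \<open>r\<close> is less than the height of the tower, \<open>x\<close> lies on the first block of strand 0.\<close>
  have "x = shift (strand 0 r) y" using x by (simp add: strand_def)
  then have orb: "orbit_of X speedup x = range (\<lambda>t. shift (strand 0 t) y)"
    using orbit_of_speedup[OF y] by simp
  have "z \<in> odometer_space \<alpha> closure_of (orbit_of X speedup x)" if z: "z \<in> X" for z
    unfolding in_closure_of
  proof (intro conjI allI impI z)
    fix U assume "z \<in> U \<and> openin (odometer_space \<alpha>) U"
    then obtain n where n: "\<And>w. w \<in> X \<Longrightarrow> residue n w = residue n z \<Longrightarrow> w \<in> U"
      using residue_nhds by metis
    obtain t where "residue n (shift (strand 0 t) y) = residue n z"
      using strand_hits_residue y z by blast
    then have "shift (strand 0 t) y \<in> U" by (intro n) simp_all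
    then show "\<exists>w. w \<in> orbit_of X speedup x \<and> w \<in> U"
      using orb by blast
  qed
  then show "odometer_space \<alpha> closure_of (orbit_of X speedup x) = X"
    by (intro equalityI closure_of_subset_topspace subsetI)
qed

end

theorem theorem3p8:
  fixes \<alpha> :: "nat \<Rightarrow> nat" and c :: nat
  assumes "\<And>i. \<alpha> i \<ge> 2"
    and "c \<ge> 1"
    and "\<exists>N. \<forall>i\<ge>N. gcd c (\<alpha> i) = 1"
  shows "\<exists>S. bounded_speedup (odometer_space \<alpha>) (odometer \<alpha>) S \<and>
             has_orbit_number (odometer_space \<alpha>) (odometer \<alpha>) S c \<and>
             minimal_homeo (odometer_space \<alpha>) S"
proof -
  obtain N where "\<And>i. i \<ge> N \<Longrightarrow> gcd c (\<alpha> i) = 1"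
    using assms(3) by blast
  then interpret odometer_speedup \<alpha> c N
    using assms(1,2) by unfold_locales
  show ?thesis
    using bounded_speedup_speedup has_orbit_number_speedup minimal_homeo_speedup by blast
qed

end
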